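(* Let $m\ge 1$ be an integer. The predicate $opra$ defined in the context computes (weak) composition in the oriented point calculus $\mathcal{OPRA}_m$. That is, for all base relations $b_1,b_2,b_3$ of $\mathcal{OPRA}_m$, $$opra(b_1,b_2,b_3)\iff b_3\in b_1\diamond b_2,$$ where $b_1\diamond b_2=\{b \mid (R_{b_1}\circ R_{b_2})\cap R_b\neq\emptyset\}$. Equivalently, $opra(b_1,b_2,b_3)$ holds if and only if there exist o-points $A,B,C$ with $A\,b_1\,B$, $B\,b_2\,C$ and $A\,b_3\,C$.
   Context: **O-points and angles.** An o-point (oriented point) is a pair $S=(\mathbf p_S,\phi_S)$ with $\mathbf p_S\in\mathbb R^2$ and $\phi_S$ an angle (its orientation). All angles are taken modulo $2\pi$, normalized to $]-\pi,\pi]$. For $\mathbf p_A\ne\mathbf p_B$, let $\varphi_{AB}$ be the angle between the positive $x$-axis and the vector $\mathbf p_B-\mathbf p_A$ (i.e. $\mathrm{atan2}$ of its coordinates). **Sectors.** For $i\in\mathbb Z_{4m}$ (the cyclic group, represented by $0,\dots,4m-1$), let $[i]_m$ be the set of angles (mod $2\pi$) $$[i]_m=\begin{cases}\left]2\pi\frac{i-1}{4m},\,2\pi\frac{i+1}{4m}\right[ & i \text{ odd},\\ \{2\pi\frac{i}{4m}\} & i\text{ even.}\end{cases}$$ Each angle lies in $[i]_m$ for exactly one $i$. **Base relations of $\mathcal{OPRA}_m$.** There are two kinds, with $i,j\in\mathbb Z_{4m}$: - ${}_m\angle_i^j$: $A\;{}_m\angle_i^j\;B$ holds iff $\mathbf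 p_A\ne\mathbf p_B$, $\varphi_{AB}-\phi_A\in[i]_m$ and $\varphi_{BA}-\phi_B\in[j]_m$. - ${}_m\angle i$: $A\;{}_m\angle i\;B$ holds iff $\mathbf p_A=\mathbf p_B$ and $\phi_B-\phi_A\in[i]_m$. $R_b$ denotes the set of pairs of o-points in base relation $b$, and $R\circ S=\{(x,z)\mid\exists y.\,(x,y)\in R,\ (y,z)\in S\}$. **The algorithm (predicate $opra$).** Below, $x \bmod n$ is the least nonnegative residue of the integer $x$; indices are integers in $\{0,\dots,4m-1\}$. - $turn_m(i,j,k)$ iff $\bigl|\,((i+j+k+2m)\bmod 4m)-2m\,\bigr|\le (i\bmod 2)\cdot(j\bmod 2)$. - $sign_m(i)=0$ if $i\bmod 4m\in\{0,2m\}$; otherwise $sign_m(i)=1$ if $i\bmod 4m<2m$; otherwise $sign_m(i)=-1$. - $triangle_m(i,j,k)$ iff $turn_m(i,j,k-2m)$ and $(i,j,k)\neq(2m,2m,2m)$ and $sign_m(i)=sign_m(j)=sign_m(k)$. The predicate $opra$ is then defined by cases: - $opra({}_m\angle i,{}_m\angle k,{}_m\angle s)$ iff $turn_m(i,k,-s)$. - $opra({}_m\angle i,{}_m\angle k,{}_m\angle_s^t)$, $opra({}_m\angle i,{}_m\angle_k^l,{}_m\angle s)$ and $opra({}_m\angle_i^j,{}_m\angle k,{}_m\angle s)$ are always false. - $opra({}_m\angle i,{}_m\angle_k^l,{}_m\angle_s^t)$ iff $l=t$ and $turn_m(i,k,-s)$. - $opra({}_m\angle_i^j,{}_m\angle k,{}_m\angle_s^t)$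 iff $i=s$ and $turn_m(t,k,-j)$. - $opra({}_m\angle_i^j,{}_m\angle_k^l,{}_m\angle s)$ iff $j=k$ and $turn_m(i,-l,-s)$. - $opra({}_m\angle_i^j,{}_m\angle_k^l,{}_m\angle_s^t)$ iff there exist integers $0\le u,v,w<4m$ with $turn_m(u,-i,s)$, $turn_m(v,-k,j)$, $turn_m(w,-t,l)$ and $triangle_m(u,v,w)$. *)

theory Defs
  imports "HOL-Analysis.Analysis" "HOL-Library.Real_Mod"
begin

type_synonym opoint = "(real^2) \<times> real"

abbreviation position :: "opoint \<Rightarrow> real^2" where "position \<equiv> fst"
abbreviation orientation :: "opoint \<Rightarrow> real" where "orientation \<equiv> snd"

definition opoints :: "opoint set" where
  "opoints = UNIV \<times> {-pi<..pi}"

text \<open>\<^const>\<open>Arg\<close> has values in \<open>]-pi, pi]\<close>, so this is \<open>atan2\<close> of the coordinates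
  of the vector from \<open>A\<close> to \<open>B\<close>.\<close>

definition direction :: "opoint \<Rightarrow> opoint \<Rightarrow> real" where
  "direction A B = (let v = position B - position A in Arg (Complex (v $ 1) (v $ 2)))"

text \<open>A set of angles modulo \<open>2 * pi\<close> is represented by the set of all real representatives of
  its members, so differences of angles need not be normalized before testing membership.\<close>

definition sector :: "int \<Rightarrow> int \<Rightarrow> real set" where
  "sector m i = {\<alpha>. \<exists>\<beta>. [\<alpha> = \<beta>] (rmod (2 * pi)) \<and>
     \<beta> \<in> (if odd i
          then {2 * pi * (of_int (i - 1) / of_int (4 * m)) <..<
                2 * pi * (of_int (i + 1) / of_int (4 * m))}
          else {2 * pi * (of_int i / of_int (4 * m))})}"

text \<open>\<open>Distinct i j\<close> stands for the relation with lower index \<open>i\<close> and upper index \<open>j\<close> between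
  o-points at different positions, \<open>Same i\<close> for the relation with index \<open>i\<close> between o-points at
  the same position.\<close>

datatype base_relation = Distinct int int | Same int

definition base_relations :: "int \<Rightarrow> base_relation set" where
  "base_relations m =
     {Distinct i j | i j. i \<in> {0..<4 * m} \<and> j \<in> {0..<4 * m}} \<union> {Same i | i. i \<in> {0..<4 * m}}"

fun holds :: "int \<Rightarrow> base_relation \<Rightarrow> opoint \<Rightarrow> opoint \<Rightarrow> bool" where
  "holds m (Distinct i j) A B \<longleftrightarrow>
     position A \<noteq> position B \<and>
     direction A B - orientation A \<in> sector m i \<and>
     direction B A - orientation B \<in> sector m j"
| "holds m (Same i) A B \<longleftrightarrow>
     position A = position B \<and> orientation B - orientation A \<in> sector m i"

definition rel_of :: "int \<Rightarrow> base_relation \<Rightarrow> (opoint \<times> opoint) set" where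
  "rel_of m b = {(A, B). A \<in> opoints \<and> B \<in> opoints \<and> holds m b A B}"

definition weak_comp :: "int \<Rightarrow> base_relation \<Rightarrow> base_relation \<Rightarrow> base_relation set" where
  "weak_comp m b1 b2 =
     {b \<in> base_relations m. (rel_of m b1 O rel_of m b2) \<inter> rel_of m b \<noteq> {}}"

text \<open>On \<^typ>\<open>int\<close>, \<open>x mod n\<close> is the least nonnegative residue for \<open>n > 0\<close>, also for negative \<open>x\<close>.\<close>

definition turn :: "int \<Rightarrow> int \<Rightarrow> int \<Rightarrow> int \<Rightarrow> bool" where
  "turn m i j k \<longleftrightarrow> \<bar>((i + j + k + 2 * m) mod (4 * m)) - 2 * m\<bar> \<le> (i mod 2) * (j mod 2)"

definition index_sign :: "int \<Rightarrow> int \<Rightarrow> int" where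
  "index_sign m i =
     (if i mod (4 * m) \<in> {0, 2 * m} then 0
      else if i mod (4 * m) < 2 * m then 1
      else - 1)"

definition triangle :: "int \<Rightarrow> int \<Rightarrow> int \<Rightarrow> int \<Rightarrow> bool" where
  "triangle m i j k \<longleftrightarrow>
     turn m i j (k - 2 * m) \<and>
     (i, j, k) \<noteq> (2 * m, 2 * m, 2 * m) \<and>
     index_sign m i = index_sign m j \<and> index_sign m j = index_sign m k"

fun opra :: "int \<Rightarrow> base_relation \<Rightarrow> base_relation \<Rightarrow> base_relation \<Rightarrow> bool" where
  "opra m (Same i) (Same k) (Same s) \<longleftrightarrow> turn m i k (- s)"
| "opra m (Same i) (Same k) (Distinct s t) \<longleftrightarrow> False"
| "opra m (Same i) (Distinct k l) (Same s) \<longleftrightarrow> False"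
| "opra m (Distinct i j) (Same k) (Same s) \<longleftrightarrow> False"
| "opra m (Same i) (Distinct k l) (Distinct s t) \<longleftrightarrow> l = t \<and> turn m i k (- s)"
| "opra m (Distinct i j) (Same k) (Distinct s t) \<longleftrightarrow> i = s \<and> turn m t k (- j)"
| "opra m (Distinct i j) (Distinct k l) (Same s) \<longleftrightarrow> j = k \<and> turn m i (- l) (- s)"
| "opra m (Distinct i j) (Distinct k l) (Distinct s t) \<longleftrightarrow>
     (\<exists>u\<in>{0..<4 * m}. \<exists>v\<in>{0..<4 * m}. \<exists>w\<in>{0..<4 * m}.
        turn m u (- i) s \<and> turn m v (- k) j \<and> turn m w (- t) l \<and> triangle m u v w)"

end

theory Submission
  imports Defs "HOL-Number_Theory.Cong"
begin

text \<open>
  Angles are encoded as unit complex numbers: for points \<open>p\<close>, \<open>q\<close>, \<open>r\<close>, the angle from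
  \<open>r - p\<close> to \<open>q - p\<close> is \<open>sgn (q - p) / sgn (r - p)\<close>.  In the unit \<open>2 * pi / (4 * m)\<close> the
  sectors are the even integers and the open intervals of radius 1 around the odd integers, so
  \<open>turn m i j k\<close> says that some angles in the three sectors add up to 0 modulo \<open>2 * pi\<close>; moreover
  the angle in the first sector can then be prescribed arbitrarily.

  Three unit numbers are the angles of a possibly degenerate triangle with distinct vertices iff
  their product is \<open>- 1\<close>, their imaginary parts have the same sign (the orientation of the
  triangle) and not all of them are \<open>- 1\<close>; hence \<open>triangle m u v w\<close> says that \<open>u\<close>, \<open>v\<close>, \<open>w\<close>
  contain the angles of a triangle.  Since each of the first arguments \<open>u\<close>, \<open>v\<close>, \<open>w\<close> of the
  turns in \<open>opra\<close> can be prescribed, the triangle can be fixed first, and the orientation of each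
  vertex can then be chosen independently.
\<close>

subsection \<open>Sectors and turns\<close>

text \<open>The sectors before reduction modulo \<open>2 * pi\<close>, for angles measured in units of
  \<open>2 * pi / (4 * m)\<close>.\<close>

definition cell :: "int \<Rightarrow> real \<Rightarrow> bool" where
  "cell k x \<longleftrightarrow> (if odd k then \<bar>x - of_int k\<bar> < 1 else x = of_int k)"

lemma cell_exists: "\<exists>k. cell k x"
proof -
  have "of_int \<lfloor>x\<rfloor> \<le> x" "x < of_int \<lfloor>x\<rfloor> + 1" by linarith+
  \<comment> \<open>A non-integer is at distance less than 1 from both neighbouring integers, one of
    which is odd; an integer lies in its own cell.\<close>
  then have "cell (if odd \<lfloor>x\<rfloor> \<or> x = of_int \<lfloor>x\<rfloor> then \<lfloor>x\<rfloor> else \<lfloor>x\<rfloor> + 1) x"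
    by (auto simp: cell_def abs_less_iff; linarith?)
  then show ?thesis ..
qed

lemma cell_nonempty: "\<exists>x. cell k x"
  by (rule exI[of _ "of_int k"]) (simp add: cell_def)

lemma cell_uminus: "cell (- k) (- x) \<longleftrightarrow> cell k x"
  by (auto simp: cell_def)

lemma cell_shift: "even n \<Longrightarrow> cell (k + n) (x + of_int n) \<longleftrightarrow> cell k x"
  by (auto simp: cell_def)

text \<open>The deviation of a point from its index is 0 for even and below 1 for odd indices, so a
  nonzero \<open>i + j + k\<close> is smaller in absolute value than the number of odd indices. It
  also has the parity of that number. So it vanishes unless all three indices are odd, and then it
  is 1 or -1. This is why the bound need not mention \<open>k\<close>.\<close>

lemma cell_sum:
  assumes "cell i x" "cell j y" "cell k z" "x + y + z = 0"
  shows "\<bar>i + j + k\<bar> \<le> (i mod 2) * (j mod 2)"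
proof -
  have parity: "i mod 2 = (if odd i then 1 else 0)" for i :: int
    by (simp add: odd_iff_mod_2_eq_one even_iff_mod_2_eq_zero)
  have "real_of_int (i + j + k) = (of_int i - x) + (of_int j - y) + (of_int k - z)"
    using assms(4) by simp
  \<comment> \<open>The first alternative covers three even indices, where the strict inequality
    would read \<open>0 < 0\<close>.\<close>
  then have "i + j + k = 0 \<or> \<bar>real_of_int (i + j + k)\<bar> < of_int (i mod 2 + j mod 2 + k mod 2)"
    using assms(1-3) unfolding cell_def parity
    by (auto split: if_splits)
  then have "i + j + k = 0 \<or> \<bar>i + j + k\<bar> < i mod 2 + j mod 2 + k mod 2"
    by linarith
  then show ?thesis
    unfolding parity by (auto split: if_splits) presburger+
qed

text \<open>Converse of \<open>cell_sum\<close> in a strong form: \<open>x\<close> is an arbitrary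
  point of its cell, and its deviation is absorbed by the cells of odd index among \<open>j\<close>
  and \<open>k\<close>.\<close>

lemma cell_split:
  assumes "cell i x" "\<bar>i + j + k\<bar> \<le> (i mod 2) * (j mod 2)"
  obtains y z where "cell j y" "cell k z" "x + y + z = 0"
proof (cases "odd i \<and> odd j")
  case False
  then have "i + j + k = 0" using assms(2) by (auto simp: odd_iff_mod_2_eq_one)
  then have k: "k = - i - j" by simp
  show ?thesis
  proof (rule that)
    show "cell j (of_int j)" by (simp add: cell_def)
    show "cell k (- x - of_int j)" using assms(1) False by (auto simp: cell_def k)
  qed simp
next
  case True
  define e t where "e = i + j + k" and "t = x - of_int i"
  have e: "\<bar>e\<bar> \<le> 1" and t: "\<bar>t\<bar> < 1"
    using assms True by (auto simp: e_def t_def cell_def odd_iff_mod_2_eq_one)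
  have k: "k = e - i - j" and x: "x = of_int i + t" by (simp_all add: e_def t_def)
  show ?thesis
  proof (cases "e = 0")
    \<comment> \<open>Here \<open>k\<close> is even, so \<open>z\<close> is forced to be
      \<open>k\<close>, and \<open>y\<close> in the odd cell \<open>j\<close> takes the whole
      deviation \<open>t\<close>.\<close>
    case e0: True
    show ?thesis
    proof (rule that)
      show "cell k (of_int k)" by (simp add: cell_def)
      show "cell j (- x - of_int k)" using t True by (simp add: cell_def k x e0)
    qed simp
  next
    case False
    \<comment> \<open>Since \<open>e\<close> is 1 or -1 and \<open>i\<close>, \<open>j\<close> are
      odd, \<open>k\<close> is odd too, so both remaining cells are intervals.\<close>
    then have "odd e" using e by (cases "e = 1") (auto simp: abs_if split: if_splits)
    have e': "\<bar>real_of_int e\<bar> \<le> 1" using e by linarith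
    show ?thesis
    proof (rule that) \<comment> \<open>the defect \<open>t + e\<close>, less than 2, is shared equally by the two other cells\<close>
      show "cell j (of_int j - (t + of_int e) / 2)"
        using t e' True by (simp add: cell_def)
      show "cell k (of_int k - (t + of_int e) / 2)"
        using t e' True \<open>odd e\<close> by (simp add: cell_def k)
    qed (simp add: k x field_simps)
  qed
qed

text \<open>Adding \<open>2 * m\<close> before the reduction and subtracting it afterwards selects
  the representative of \<open>i + j + k\<close> between \<open>- 2 * m\<close> and
  \<open>2 * m - 1\<close>. As the bound is at most 1 and \<open>m \<ge> 1\<close>, any
  representative \<open>d\<close> within the bound is this one.\<close>

lemma turn_iff_cong:
  assumes "m \<ge> 1"
  shows "turn m i j k \<longleftrightarrow>
    (\<exists>d. [d = i + j + k] (mod (4 * m)) \<and> \<bar>d\<bar> \<le> (i mod 2) * (j mod 2))"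
proof
  assume "turn m i j k"
  then have "\<bar>(i + j + k + 2 * m) mod (4 * m) - 2 * m\<bar> \<le> (i mod 2) * (j mod 2)"
    by (simp add: turn_def)
  moreover have "[(i + j + k + 2 * m) mod (4 * m) - 2 * m = i + j + k + 2 * m - 2 * m] (mod (4 * m))"
    by (intro cong_diff cong_mod_leftI cong_refl) 
  ultimately show "\<exists>d. [d = i + j + k] (mod (4 * m)) \<and> \<bar>d\<bar> \<le> (i mod 2) * (j mod 2)"
    by (intro exI[of _ "(i + j + k + 2 * m) mod (4 * m) - 2 * m"]) simp
next
  assume "\<exists>d. [d = i + j + k] (mod (4 * m)) \<and> \<bar>d\<bar> \<le> (i mod 2) * (j mod 2)"
  then obtain d where d: "[d = i + j + k] (mod (4 * m))" "\<bar>d\<bar> \<le> (i mod 2) * (j mod 2)" by blast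
  have "(i mod 2) * (j mod 2) \<le> 1" by (cases "odd i"; cases "odd j") (auto simp: odd_iff_mod_2_eq_one)
  then have "\<bar>d\<bar> \<le> 1" using d(2) by linarith
  then have "(d + 2 * m) mod (4 * m) = d + 2 * m" using assms by (intro mod_pos_pos_trivial) auto
  moreover have "(i + j + k + 2 * m) mod (4 * m) = (d + 2 * m) mod (4 * m)"
    using cong_add[OF d(1) cong_refl[of "2 * m"]] by (simp add: cong_def)
  ultimately show "turn m i j k" using d(2) by (simp add: turn_def)
qed

text \<open>A full turn of the angle is a shift by \<open>4 * m\<close> in the new unit. This number
  is even, so \<open>cell_shift\<close> moves the reduction from the angle to the index.\<close>

lemma sector_iff_cell:
  assumes "m \<ge> 1"
  shows "\<alpha> \<in> sector m i \<longleftrightarrow>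
    (\<exists>k. [k = i] (mod (4 * m)) \<and> cell k (\<alpha> * (2 * of_int m) / pi))"
proof -
  have base: "\<beta> \<in> (if odd i
          then {2 * pi * (of_int (i - 1) / of_int (4 * m)) <..<
                2 * pi * (of_int (i + 1) / of_int (4 * m))}
          else {2 * pi * (of_int i / of_int (4 * m))}) \<longleftrightarrow> cell i (\<beta> * (2 * of_int m) / pi)" for \<beta>
    using assms by (auto simp: cell_def field_simps abs_less_iff)
  have shift: "(\<alpha> + of_int n * (2 * pi)) * (2 * of_int m) / pi
      = \<alpha> * (2 * of_int m) / pi + of_int (4 * m * n)" for n
    by (simp add: field_simps)
  have "\<alpha> \<in> sector m i \<longleftrightarrow> (\<exists>n. cell i (\<alpha> * (2 * of_int m) / pi + of_int (4 * m * n)))"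
    unfolding sector_def base rcong_altdef mem_Collect_eq shift[symmetric] by blast
  also have "\<dots> \<longleftrightarrow> (\<exists>n. cell (i - 4 * m * n) (\<alpha> * (2 * of_int m) / pi))"
    using cell_shift[of "4 * m * n" "i - 4 * m * n" for n] by simp
  also have "\<dots> \<longleftrightarrow> (\<exists>k. [k = i] (mod (4 * m)) \<and> cell k (\<alpha> * (2 * of_int m) / pi))"
  proof -
    have "[k = i] (mod (4 * m)) \<longleftrightarrow> (\<exists>n. k = i - 4 * m * n)" for k
      by (metis add_diff_cancel_right' cong_iff_lin diff_add_cancel mult.commute)
    then show ?thesis by auto
  qed
  finally show ?thesis .
qed

section \<open>Sectors as subsets of the unit circle\<close>

definition unit_sector :: "int \<Rightarrow> int \<Rightarrow> complex set" where
  "unit_sector m i = cis ` sector m i"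

lemma cis_in_unit_sector_iff: "cis \<alpha> \<in> unit_sector m i \<longleftrightarrow> \<alpha> \<in> sector m i"
proof
  assume "cis \<alpha> \<in> unit_sector m i"
  then obtain \<beta> where "\<beta> \<in> sector m i" "[\<alpha> = \<beta>] (rmod (2 * pi))"
    by (auto simp: unit_sector_def cis_eq_iff)
  then show "\<alpha> \<in> sector m i"
    unfolding sector_def by (blast intro: rcong_trans)
qed (auto simp: unit_sector_def)

lemma norm_unit_sector: "z \<in> unit_sector m i \<Longrightarrow> norm z = 1"
  by (auto simp: unit_sector_def)

lemma unit_sector_nonzero: "z \<in> unit_sector m i \<Longrightarrow> z \<noteq> 0"
  using norm_unit_sector by fastforce

lemma unit_eq_cis: "norm z = 1 \<Longrightarrow> \<exists>\<alpha>. z = cis \<alpha>"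
  by (rule exI[of _ "Arg z"], subst cis_Arg) (auto simp: sgn_div_norm)

lemma cis_in_unit_sector_iff_cell:
  assumes "m \<ge> 1"
  shows "cis (x * pi / (2 * of_int m)) \<in> unit_sector m i \<longleftrightarrow>
    (\<exists>k. [k = i] (mod (4 * m)) \<and> cell k x)"
  using assms by (simp add: cis_in_unit_sector_iff sector_iff_cell)

lemma unit_sector_obtain_cell:
  assumes "m \<ge> 1" "z \<in> unit_sector m i"
  obtains k x where "[k = i] (mod (4 * m))" "cell k x" "z = cis (x * pi / (2 * of_int m))"
proof -
  obtain \<alpha> where z: "z = cis \<alpha>" "\<alpha> \<in> sector m i" using assms(2) by (auto simp: unit_sector_def)
  moreover have "\<alpha> = \<alpha> * (2 * of_int m) / pi * pi / (2 * of_int m)" using assms(1) by simp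
  ultimately show ?thesis
    using that sector_iff_cell[OF assms(1)] by metis
qed

lemma unit_sector_nonempty:
  assumes "m \<ge> 1"
  shows "\<exists>z. z \<in> unit_sector m i"
  using cell_nonempty[of i] cis_in_unit_sector_iff_cell[OF assms] cong_refl by blast

lemma one_in_unit_sector:
  assumes "m \<ge> 1"
  shows "1 \<in> unit_sector m 0"
proof -
  have "cis (0 * pi / (2 * of_int m)) \<in> unit_sector m 0"
    unfolding cis_in_unit_sector_iff_cell[OF assms] by (intro exI[of _ 0]) (simp add: cell_def)
  then show ?thesis by simp
qed

lemma unit_sector_cong: "m \<ge> 1 \<Longrightarrow> [i = j] (mod (4 * m)) \<Longrightarrow> unit_sector m i = unit_sector m j"
  unfolding unit_sector_def by (rule arg_cong[of _ _ "image cis"]) (auto simp: sector_iff_cell cong_def)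

lemma unit_sectors_cover:
  assumes "m \<ge> 1" "norm z = 1"
  shows "\<exists>i\<in>{0..<4 * m}. z \<in> unit_sector m i"
proof -
  obtain \<alpha> where z: "z = cis \<alpha>" using unit_eq_cis assms(2) by blast
  obtain k where "cell k (\<alpha> * (2 * of_int m) / pi)" using cell_exists by blast
  then have "z \<in> unit_sector m (k mod (4 * m))"
    unfolding z cis_in_unit_sector_iff sector_iff_cell[OF assms(1)] by (auto simp: cong_def)
  then show ?thesis using assms(1) by (intro bexI[of _ "k mod (4 * m)"]) auto
qed

lemma inverse_in_unit_sector:
  assumes "m \<ge> 1" "z \<in> unit_sector m i"
  shows "inverse z \<in> unit_sector m (- i)"
proof -
  obtain k x where "[k = i] (mod (4 * m))" "cell k x" and z: "z = cis (x * pi / (2 * of_int m))"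
    using unit_sector_obtain_cell[OF assms] .
  then have "[- k = - i] (mod (4 * m))" "cell (- k) (- x)"
    by (simp_all add: cong_minus_minus_iff cell_uminus)
  then show ?thesis
    using cis_in_unit_sector_iff_cell[OF assms(1), of "- x"] by (auto simp: z)
qed

lemma minus_in_unit_sector:
  assumes "m \<ge> 1" "z \<in> unit_sector m (i - 2 * m)"
  shows "- z \<in> unit_sector m i"
proof -
  obtain k x where k: "[k = i - 2 * m] (mod (4 * m))" "cell k x"
      and z: "z = cis (x * pi / (2 * of_int m))"
    using unit_sector_obtain_cell[OF assms] .
  have "[k + 2 * m = i] (mod (4 * m))" using cong_add[OF k(1) cong_refl[of "2 * m"]] by simp
  moreover have "cell (k + 2 * m) (x + of_int (2 * m))" using k(2) by (subst cell_shift) auto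
  moreover have "- z = cis ((x + of_int (2 * m)) * pi / (2 * of_int m))"
  proof -
    have "(x + of_int (2 * m)) * pi / (2 * of_int m) = x * pi / (2 * of_int m) + pi"
      using assms(1) by (simp add: field_simps)
    then show ?thesis by (simp add: z cis_mult[symmetric])
  qed
  ultimately show ?thesis using cis_in_unit_sector_iff_cell[OF assms(1)] by metis
qed

lemma minus_in_unit_sector_iff:
  assumes "m \<ge> 1"
  shows "- z \<in> unit_sector m i \<longleftrightarrow> z \<in> unit_sector m (i - 2 * m)"
proof
  assume "- z \<in> unit_sector m i"
  \<comment> \<open>Two half turns make a full one, so the one-sided lemma, applied to
    \<open>- z\<close>, also gives the converse.\<close>
  also have "unit_sector m i = unit_sector m (i - 2 * m - 2 * m)"
    by (intro unit_sector_cong[OF assms]) (simp add: cong_iff_dvd_diff)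
  finally show "z \<in> unit_sector m (i - 2 * m)" using minus_in_unit_sector[OF assms] by fastforce
qed (rule minus_in_unit_sector[OF assms])

text \<open>The left-hand side does not mention \<open>x\<close>. Hence a solution of
  \<open>x * y * z = 1\<close> for one \<open>x\<close> in the sector gives one for every
  \<open>x\<close> in it, which lets an angle be fixed before the turn is applied.\<close>

lemma turn_iff_unit_sector:
  assumes m: "m \<ge> 1" and x: "x \<in> unit_sector m i"
  shows "turn m i j k \<longleftrightarrow> (\<exists>y\<in>unit_sector m j. \<exists>z\<in>unit_sector m k. x * y * z = 1)"
proof
  assume "turn m i j k"
  then obtain d where d: "[d = i + j + k] (mod (4 * m))" "\<bar>d\<bar> \<le> (i mod 2) * (j mod 2)"
    unfolding turn_iff_cong[OF m] by blast
  obtain i' a where i': "[i' = i] (mod (4 * m))" "cell i' a"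
    and xa: "x = cis (a * pi / (2 * of_int m))"
    using unit_sector_obtain_cell[OF m x] .
  \<comment> \<open>The third index takes up all multiples of \<open>4 * m\<close>, so that
    \<open>i' + j + k'\<close> is exactly \<open>d\<close>.\<close>
  define k' where "k' = d - i' - j"
  have "[k' = i + j + k - i - j] (mod (4 * m))"
    unfolding k'_def by (intro cong_diff d i' cong_refl)
  then have k': "[k' = k] (mod (4 * m))" by simp
  \<comment> \<open>The modulus \<open>4 * m\<close> is even, so the bound is the same for all
    representatives of an index.\<close>
  have "[i' = i] (mod 2)" using i'(1) by (rule cong_dvd_modulus) simp
  then have "\<bar>i' + j + k'\<bar> \<le> (i' mod 2) * (j mod 2)" using d(2) by (simp add: k'_def cong_def)
  then obtain b c where "cell j b" "cell k' c" and sum: "a + b + c = 0"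
    using cell_split[OF i'(2)] by blast
  then have "cis (b * pi / (2 * of_int m)) \<in> unit_sector m j" "cis (c * pi / (2 * of_int m)) \<in> unit_sector m k"
    using cis_in_unit_sector_iff_cell[OF m] k' cong_refl by blast+
  moreover have "x * cis (b * pi / (2 * of_int m)) * cis (c * pi / (2 * of_int m)) = 1"
    using sum by (simp add: xa cis_mult flip: add_divide_distrib distrib_right)
  ultimately show "\<exists>y\<in>unit_sector m j. \<exists>z\<in>unit_sector m k. x * y * z = 1" by blast
next
  assume "\<exists>y\<in>unit_sector m j. \<exists>z\<in>unit_sector m k. x * y * z = 1"
  then obtain y z where y: "y \<in> unit_sector m j" and z: "z \<in> unit_sector m k" and xyz: "x * y * z = 1" by blast
  obtain i' a where i': "[i' = i] (mod (4 * m))" "cell i' a"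
    and xa: "x = cis (a * pi / (2 * of_int m))" using unit_sector_obtain_cell[OF m x] .
  obtain j' b where j': "[j' = j] (mod (4 * m))" "cell j' b"
    and yb: "y = cis (b * pi / (2 * of_int m))" using unit_sector_obtain_cell[OF m y] .
  obtain k' c where k': "[k' = k] (mod (4 * m))" "cell k' c"
    and zc: "z = cis (c * pi / (2 * of_int m))" using unit_sector_obtain_cell[OF m z] .
  have "cis ((a + b + c) * pi / (2 * of_int m)) = 1"
    using xyz by (simp add: xa yb zc cis_mult flip: add_divide_distrib distrib_right)
  then obtain n :: int where "(a + b + c) * pi / (2 * of_int m) = of_int n * (2 * pi)"
    unfolding cis_eq_1_iff by blast
  then have "pi * (a + b + c) = pi * of_int (4 * m * n)" using m by (simp add: field_simps)
  then have "a + b + c = of_int (4 * m * n)" unfolding mult_left_cancel[OF pi_neq_zero] .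
  \<comment> \<open>The full turns are moved into the third angle because \<open>cell_sum\<close>
    needs a sum that is exactly 0.\<close>
  then have "a + b + (c + of_int (- (4 * m * n))) = 0" by simp
  moreover have "cell (k' + - (4 * m * n)) (c + of_int (- (4 * m * n)))"
    using k'(2) by (subst cell_shift) auto
  ultimately have "\<bar>i' + j' + (k' + - (4 * m * n))\<bar> \<le> (i' mod 2) * (j' mod 2)"
    using cell_sum i'(2) j'(2) by blast
  moreover have "[i' = i] (mod 2)" using i'(1) by (rule cong_dvd_modulus) simp
  moreover have "[j' = j] (mod 2)" using j'(1) by (rule cong_dvd_modulus) simp
  moreover have "[i' + j' + (k' + - (4 * m * n)) = i + j + (k + 0)] (mod (4 * m))"
    by (intro cong_add i' j' k') (simp add: cong_iff_dvd_diff)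
  ultimately show "turn m i j k"
    unfolding turn_iff_cong[OF m] cong_def
    by (intro exI[of _ "i' + j' + (k' + - (4 * m * n))"]) simp
qed

text \<open>The number 1 lies in the sector of the even index 0, so a turn through it has no slack:
  \<open>z * 1 * inverse z = 1\<close> forces \<open>i\<close> and \<open>j\<close> to be congruent
  modulo \<open>4 * m\<close>.\<close>

lemma unit_sector_unique:
  assumes m: "m \<ge> 1" and "z \<in> unit_sector m i" "z \<in> unit_sector m j" "i \<in> {0..<4 * m}" "j \<in> {0..<4 * m}"
  shows "i = j"
proof -
  have "z * 1 * inverse z = 1" using unit_sector_nonzero[OF assms(2)] by simp
  then have "turn m i 0 (- j)"
    using turn_iff_unit_sector[OF m assms(2)] one_in_unit_sector[OF m]
      inverse_in_unit_sector[OF m assms(3)] by blast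
  then have "[0 = i + 0 + - j] (mod (4 * m))" unfolding turn_iff_cong[OF m] by simp
  then have "[i = j] (mod (4 * m))" using dvd_diff_commute[of "4 * m" i j] by (simp add: cong_iff_dvd_diff)
  then show ?thesis using assms(4,5) by (simp add: cong_def)
qed

text \<open>The directions 0 and \<open>pi\<close> have the even indices 0 and \<open>2 * m\<close>,
  so every other sector lies inside one open half circle and the sine has constant sign on
  it.\<close>

lemma index_sign_unit_sector:
  assumes m: "m \<ge> 1" and z: "z \<in> unit_sector m i"
  shows "of_int (index_sign m i) = sgn (Im z)"
proof -
  define k where "k = i mod (4 * m)"
  have k: "k \<in> {0..<4 * m}" using m by (simp add: k_def)
  have "z \<in> unit_sector m k" using z unit_sector_cong[OF m, of k i] by (simp add: k_def cong_def)
  then obtain k' x' where k': "[k' = k] (mod (4 * m))" "cell k' x'"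
      and z': "z = cis (x' * pi / (2 * of_int m))" using unit_sector_obtain_cell[OF m] by metis
  obtain n where n: "k = k' + 4 * m * n" using k'(1) by (metis cong_iff_lin)
  define x where "x = x' + of_int (4 * m * n)"
  have x: "cell k x" unfolding n x_def using k'(2) by (subst cell_shift) auto
  have zx: "z = cis (x * pi / (2 * of_int m))"
  proof -
    have "x * pi / (2 * of_int m) = x' * pi / (2 * of_int m) + of_int n * (2 * pi)"
      using m by (simp add: x_def field_simps)
    then show ?thesis unfolding z' cis_eq_iff rcong_altdef by blast
  qed
  define t where "t = x * pi / (2 * of_int m)"
  have Im: "Im z = sin t" by (simp add: zx t_def)
  have mono: "t < s * pi \<longleftrightarrow> x < s * (2 * of_int m)" "s * pi < t \<longleftrightarrow> s * (2 * of_int m) < x" for s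
    using m by (auto simp: t_def field_simps)
  consider "k = 0" | "k = 2 * m" | "0 < k" "k < 2 * m" | "2 * m < k" using k by fastforce
  then show ?thesis
  proof cases
    case 1
    then show ?thesis using x by (simp add: index_sign_def Im t_def cell_def flip: k_def)
  next
    case 2
    then show ?thesis using x m by (simp add: index_sign_def Im t_def cell_def flip: k_def)
  next
    case 3
    have "0 < x" "x < of_int (2 * m)"
      using x 3 unfolding cell_def by (auto split: if_splits simp: abs_less_iff)
    then have "sin t > 0" using mono(1)[of 1] mono(2)[of 0] by (intro sin_gt_zero) auto
    then show ?thesis using 3 by (simp add: index_sign_def Im flip: k_def)
  next
    case 4
    have "of_int (2 * m) < x" "x < of_int (4 * m)"
      using x 4 k unfolding cell_def by (auto split: if_splits simp: abs_less_iff)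
    then have "sin t < 0" using mono(1)[of 2] mono(2)[of 1] by (intro sin_lt_zero) auto
    then show ?thesis using 4 m by (simp add: index_sign_def Im flip: k_def)
  qed
qed

subsection \<open>Angles of triangles\<close>

definition triangle_angles :: "complex \<Rightarrow> complex \<Rightarrow> complex \<Rightarrow> bool" where
  "triangle_angles x y z \<longleftrightarrow> x * y * z = - 1 \<and>
     sgn (Im x) = sgn (Im y) \<and> sgn (Im y) = sgn (Im z) \<and> (x, y, z) \<noteq> (- 1, - 1, - 1)"

text \<open>Normalizing only introduces a positive real factor. What remains is, up to sign, the
  cross product of \<open>a\<close> and \<open>b\<close>, which is polynomial in the
  coordinates.\<close>

lemma Im_sgn_divide_sgn:
  assumes "a \<noteq> 0" "b \<noteq> 0"
  shows "sgn (Im (sgn a / sgn b)) = sgn (Im (a * cnj b))"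
proof -
  have "sgn a / sgn b = of_real (1 / (norm a * norm b)) * (a * cnj b)"
    using assms complex_norm_square[of b] by (simp add: sgn_eq field_simps power2_eq_square)
  then have "Im (sgn a / sgn b) = (1 / (norm a * norm b)) * Im (a * cnj b)" 
    by (simp only: Im_complex_of_real Re_complex_of_real times_complex.sel)
  then show ?thesis using assms by (simp add: sgn_mult sgn_divide)
qed

text \<open>In terms of the edges \<open>a\<close>, \<open>b\<close>, \<open>c\<close>, traversed
  cyclically, the angles are the quotients of the directions of \<open>a\<close> and
  \<open>- c\<close>, \<open>b\<close> and \<open>- a\<close>, \<open>c\<close> and
  \<open>- b\<close>. Their product cancels to -1, and since the edges sum to 0, the three cross
  products are equal.\<close>

lemma triangle_angles_of_points:
  fixes p q r :: complex
  assumes "p \<noteq> q" "q \<noteq> r" "p \<noteq> r"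
  shows "triangle_angles (sgn (q - p) / sgn (r - p)) (sgn (r - q) / sgn (p - q))
    (sgn (p - r) / sgn (q - r))"
proof -
  define a b c where "a = q - p" and "b = r - q" and "c = p - r"
  have nz: "a \<noteq> 0" "b \<noteq> 0" "c \<noteq> 0" and sum: "c = - a - b" using assms by (auto simp: a_def b_def c_def)
  have opp: "r - p = - c" "p - q = - a" "q - r = - b" by (simp_all add: a_def b_def c_def)
  have "sgn a / sgn (- c) * (sgn b / sgn (- a)) * (sgn c / sgn (- b)) = - 1"
    using nz by (simp add: sgn_minus sgn_zero_iff)
  moreover have "sgn (Im (sgn a / sgn (- c))) = sgn (Im (sgn b / sgn (- a)))"
    "sgn (Im (sgn b / sgn (- a))) = sgn (Im (sgn c / sgn (- b)))"
    using nz by (simp_all only: Im_sgn_divide_sgn neg_equal_0_iff_equal not_False_eq_True)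
      (simp_all add: sum algebra_simps)
  \<comment> \<open>Two angles equal to -1 already make all three edges point the same way, and then
    they cannot sum to 0.\<close>
  moreover have False
    if "sgn a / sgn (- c) = - 1" "sgn b / sgn (- a) = - 1"
  proof -
    have s: "sgn b = sgn a" "sgn c = sgn a"
      using that nz by (simp_all add: sgn_minus sgn_zero_iff field_simps)
    have polar: "v = of_real (norm v) * sgn v" for v :: complex
      by (cases "v = 0") (simp_all add: sgn_eq)
    have "a + b + c = of_real (norm a) * sgn a + of_real (norm b) * sgn a + of_real (norm c) * sgn a"
      using polar[of a] polar[of b] polar[of c] unfolding s by simp
    also have "\<dots> = of_real (norm a + norm b + norm c) * sgn a" by (simp add: distrib_right)
    finally have "norm a + norm b + norm c = 0" using sum nz by (simp add: sgn_zero_iff del: of_real_add)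
    then show False using nz by (smt (verit) norm_ge_zero zero_less_norm_iff)
  qed
  ultimately show ?thesis unfolding triangle_angles_def opp a_def[symmetric] b_def[symmetric] c_def[symmetric] by blast
qed

text \<open>The lengths are those given by the law of sines, unless the triangle is degenerate.\<close>

lemma triangle_side_lengths:
  assumes xyz: "triangle_angles x y z" and unit: "norm x = 1" "norm y = 1" "norm z = 1"
  obtains a b c :: real where "a > 0" "b > 0" "c > 0" "of_real a = of_real b * y + of_real c * inverse x"
proof (cases "Im x = 0")
  case True
  then have "Im y = 0" "Im z = 0" using xyz by (auto simp: triangle_angles_def sgn_zero_iff) 
  then have pm: "v = 1 \<or> v = - 1" if "v \<in> {x, y, z}" for v
    using that True unit by (auto simp: complex_eq_iff cmod_def)
  \<comment> \<open>The product -1 leaves one or three factors -1, and three are excluded. The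
    vertex with the factor -1 lies between the other two, so the side opposite to it gets length 2
    and the others length 1.\<close>
  have "(x, y, z) \<in> {(- 1, 1, 1), (1, - 1, 1), (1, 1, - 1)}"
    using pm[of x] pm[of y] pm[of z] xyz by (auto simp: triangle_angles_def)
  then show ?thesis using that[of 1 2 1] that[of 1 1 2] that[of 2 1 1] by auto
next
  case False
  \<comment> \<open>The factor \<open>s\<close> accounts for the orientation and makes all the sines
    positive.\<close>
  define s where "s = sgn (Im x)"
  have s: "s = sgn (Im y)" "s = sgn (Im z)" using xyz by (simp_all add: s_def triangle_angles_def)
  have pos: "s * Im x > 0" "s * Im y > 0" "s * Im z > 0"
    using False s by (auto simp: s_def sgn_if split: if_splits)
  have inv: "inverse v = cnj v" if "norm v = 1" for v
    using that by (simp add: inverse_eq_divide complex_div_cnj[of 1])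
  have "x \<noteq> 0" "y \<noteq> 0" using unit by auto
  moreover have "x * y * z = - 1" using xyz by (simp add: triangle_angles_def)
  ultimately have "z = - inverse (x * y)" by (simp add: field_simps)
  also have "\<dots> = - cnj (x * y)" by (rule arg_cong[OF inv]) (simp add: norm_mult unit)
  \<comment> \<open>Up to the factor \<open>s\<close>, the real part is the addition theorem for
    \<open>Im z = Im (x * y)\<close>; the imaginary parts on the right cancel.\<close>
  finally have "of_real (s * Im z) = of_real (s * Im x) * y + of_real (s * Im y) * inverse x"
    by (simp add: inv unit complex_eq_iff algebra_simps)
  then show ?thesis using that pos by blast
qed

lemma points_of_triangle_angles:
  assumes "triangle_angles x y z" "norm x = 1" "norm y = 1" "norm z = 1"
  obtains p q r :: complex where "p \<noteq> q" "q \<noteq> r" "p \<noteq> r" "x = sgn (q - p) / sgn (r - p)"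
    "y = sgn (r - q) / sgn (p - q)" "z = sgn (p - r) / sgn (q - r)"
proof -
  have nz: "x \<noteq> 0" "y \<noteq> 0" "z \<noteq> 0" using assms by auto
  have sgn: "sgn v = v" if "norm v = 1" for v :: complex using that by (simp add: sgn_eq)
  obtain a b c :: real where pos: "a > 0" "b > 0" "c > 0"
    and sum: "of_real a = of_real b * y + of_real c * inverse x"
    using triangle_side_lengths[OF assms] .
  \<comment> \<open>One vertex is the origin and \<open>r\<close> is on the positive real axis;
    \<open>q\<close> lies in direction \<open>x\<close>. The lengths of \<open>q - p\<close>,
    \<open>r - q\<close>, \<open>r - p\<close> are \<open>a\<close>, \<open>b\<close>,
    \<open>c\<close>.\<close>
  define p q r where "p = (0 :: complex)" and "q = of_real a * x" and "r = complex_of_real c"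
  have rq: "r - q = of_real b * (- (x * y))" using nz by (simp add: q_def r_def sum field_simps)
  have "sgn (r - q) = - (x * y)"
    unfolding rq using pos assms by (simp add: sgn_mult sgn_of_real sgn sgn_minus)
  moreover have "sgn (q - p) = x" "sgn (r - p) = 1"
    using pos assms by (simp_all add: p_def q_def r_def sgn_mult sgn_of_real sgn)
  moreover have "sgn (p - q) = - sgn (q - p)" "sgn (p - r) = - sgn (r - p)" "sgn (q - r) = - sgn (r - q)"
    by (simp_all flip: sgn_minus)
  \<comment> \<open>The third angle is determined by the other two.\<close>
  moreover have "z = - 1 / (x * y)" using assms(1) nz by (simp add: triangle_angles_def field_simps)
  moreover have "p \<noteq> q" "p \<noteq> r" using pos nz by (auto simp: p_def q_def r_def)
  moreover have "r - q \<noteq> 0" unfolding rq using pos nz by simp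
  ultimately show ?thesis using nz by (intro that[of p q r]) auto
qed

text \<open>Negating the third number turns product 1 into product -1 and accounts for the
  \<open>2 * m\<close> in \<open>triangle\<close>. The signs are constant on sectors, and the sector
  of the even index \<open>2 * m\<close> is just -1, so the excluded triples correspond as
  well.\<close>

lemma triangle_iff_unit_sector:
  assumes m: "m \<ge> 1" and ran: "u \<in> {0..<4 * m}" "v \<in> {0..<4 * m}" "w \<in> {0..<4 * m}"
  shows "triangle m u v w \<longleftrightarrow>
    (\<exists>x\<in>unit_sector m u. \<exists>y\<in>unit_sector m v. \<exists>z\<in>unit_sector m w. triangle_angles x y z)"
proof -
  have sgn: "index_sign m i = index_sign m j \<longleftrightarrow> sgn (Im x) = sgn (Im y)"
    if "x \<in> unit_sector m i" "y \<in> unit_sector m j" for i j x y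
    using that by (simp flip: index_sign_unit_sector[OF m])
  have minus_one: "i = 2 * m \<longleftrightarrow> - 1 \<in> unit_sector m i" if "i \<in> {0..<4 * m}" for i
  proof -
    have "- 1 \<in> unit_sector m (2 * m)"
      using one_in_unit_sector[OF m] by (intro minus_in_unit_sector[OF m]) simp
    then show ?thesis using unit_sector_unique[OF m] that m by auto
  qed
  have only_minus_one: "x = - 1" if x_in: "x \<in> unit_sector m (2 * m)" for x
  proof -
    obtain k t where "[k = 2 * m] (mod (4 * m))" "cell k t" and x: "x = cis (t * pi / (2 * of_int m))"
      using unit_sector_obtain_cell[OF m x_in] .
    then obtain n where k: "k = 2 * m + 4 * m * n" by (metis cong_iff_lin cong_sym)
    then have "t = of_int k" using \<open>cell k t\<close> by (simp add: cell_def)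
    then have "t * pi / (2 * of_int m) = pi + of_int n * (2 * pi)" using m by (simp add: k field_simps)
    then have "[pi = t * pi / (2 * of_int m)] (rmod (2 * pi))" unfolding rcong_altdef by blast
    then show ?thesis by (simp add: x flip: cis_eq_iff)
  qed
  show ?thesis
  proof
    assume tri: "triangle m u v w"
    obtain x where x: "x \<in> unit_sector m u" using unit_sector_nonempty[OF m] by blast
    then obtain y z where y: "y \<in> unit_sector m v" and z: "z \<in> unit_sector m (w - 2 * m)"
      and "x * y * z = 1"
      using tri turn_iff_unit_sector[OF m x] by (auto simp: triangle_def)
    then have prod: "x * y * (- z) = - 1" by simp
    have z: "- z \<in> unit_sector m w" using minus_in_unit_sector[OF m z] .
    have "(x, y, - z) \<noteq> (- 1, - 1, - 1)"
    proof
      assume "(x, y, - z) = (- 1, - 1, - 1)"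
      then have "- 1 \<in> unit_sector m u" "- 1 \<in> unit_sector m v" "- 1 \<in> unit_sector m w"
        using x y z by simp_all
      then have "(u, v, w) = (2 * m, 2 * m, 2 * m)" using ran[THEN minus_one] by simp
      with tri show False by (simp add: triangle_def)
    qed
    then have "triangle_angles x y (- z)"
      using prod tri sgn[OF x y] sgn[OF y z] by (simp add: triangle_angles_def triangle_def)
    then show "\<exists>x\<in>unit_sector m u. \<exists>y\<in>unit_sector m v. \<exists>z\<in>unit_sector m w. triangle_angles x y z"
      using x y z by blast
  next
    assume "\<exists>x\<in>unit_sector m u. \<exists>y\<in>unit_sector m v. \<exists>z\<in>unit_sector m w. triangle_angles x y z"
    then obtain x y z where xyz: "x \<in> unit_sector m u" "y \<in> unit_sector m v" "z \<in> unit_sector m w"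
      and tri: "triangle_angles x y z" by blast
    have "- z \<in> unit_sector m (w - 2 * m)" using xyz(3) minus_in_unit_sector_iff[OF m, of "- z"] by simp
    moreover have "x * y * (- z) = 1" using tri by (simp add: triangle_angles_def)
    ultimately have "turn m u v (w - 2 * m)" using turn_iff_unit_sector[OF m] xyz by blast
    moreover have "(u, v, w) \<noteq> (2 * m, 2 * m, 2 * m)"
    proof
      assume "(u, v, w) = (2 * m, 2 * m, 2 * m)"
      then have "(x, y, z) = (- 1, - 1, - 1)"
        using only_minus_one[of x] only_minus_one[of y] only_minus_one[of z] xyz by simp
      with tri show False by (simp add: triangle_angles_def)
    qed
    ultimately show "triangle m u v w"
      using tri sgn[OF xyz(1,2)] sgn[OF xyz(2,3)] by (simp add: triangle_angles_def triangle_def)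
  qed
qed

subsection \<open>Oriented points and composition\<close>

definition location :: "opoint \<Rightarrow> complex" where
  "location A = Complex (position A $ 1) (position A $ 2)"

definition heading :: "opoint \<Rightarrow> complex" where
  "heading A = cis (orientation A)"

lemma location_eq_iff: "location A = location B \<longleftrightarrow> position A = position B"
  by (auto simp: location_def vec_eq_iff forall_2)

lemma heading_nonzero: "heading A \<noteq> 0"
  by (simp add: heading_def)

lemma opoint_exists:
  assumes "norm h = 1"
  obtains A where "A \<in> opoints" "location A = z" "heading A = h"
proof
  let ?A = "(vector [Re z, Im z], Arg h) :: opoint"
  show "?A \<in> opoints" using Arg_bounded[of h] by (auto simp: opoints_def)
  show "location ?A = z" by (simp add: location_def)
  have "h \<noteq> 0" using assms by auto
  then show "heading ?A = h" using assms by (simp add: heading_def cis_Arg sgn_eq)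
qed

text \<open>The locations must differ: \<open>sgn 0\<close> is 0, whereas \<open>cis (Arg 0)\<close>
  is 1.\<close>

lemma direction_in_sector_iff:
  assumes "location A \<noteq> location B"
  shows "direction A B - orientation A \<in> sector m i \<longleftrightarrow>
    sgn (location B - location A) / heading A \<in> unit_sector m i"
proof -
  have "direction A B = Arg (location B - location A)"
    by (simp add: direction_def location_def Let_def complex_diff)
  then have "cis (direction A B - orientation A) = sgn (location B - location A) / heading A"
    using assms by (simp add: heading_def cis_Arg flip: cis_divide)
  then show ?thesis by (metis cis_in_unit_sector_iff)
qed

lemma holds_Distinct_iff:
  "holds m (Distinct i j) A B \<longleftrightarrow> location A \<noteq> location B \<and>
     sgn (location B - location A) / heading A \<in> unit_sector m i \<and>
     sgn (location A - location B) / heading B \<in> unit_sector m j"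
  using direction_in_sector_iff[of A B] direction_in_sector_iff[of B A]
  by (auto simp: location_eq_iff)

lemma holds_Same_iff:
  "holds m (Same i) A B \<longleftrightarrow> location A = location B \<and> heading B / heading A \<in> unit_sector m i"
  by (simp add: location_eq_iff heading_def cis_divide cis_in_unit_sector_iff)

declare holds.simps [simp del]

section \<open>Composition, case by case\<close>

definition composable :: "int \<Rightarrow> base_relation \<Rightarrow> base_relation \<Rightarrow> base_relation \<Rightarrow> bool" where
  "composable m b1 b2 b3 \<longleftrightarrow>
     (\<exists>A\<in>opoints. \<exists>B\<in>opoints. \<exists>C\<in>opoints. holds m b1 A B \<and> holds m b2 B C \<and> holds m b3 A C)"

text \<open>Lets a configuration be given by complex numbers alone; the o-points with these data
  come from \<open>opoint_exists\<close>.\<close>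

lemma composableI:
  assumes "norm a = 1" "norm b = 1" "norm c = 1"
    and "\<And>A B C. \<lbrakk>location A = p; location B = q; location C = r;
           heading A = a; heading B = b; heading C = c\<rbrakk>
         \<Longrightarrow> holds m b1 A B \<and> holds m b2 B C \<and> holds m b3 A C"
  shows "composable m b1 b2 b3"
proof -
  obtain A where "A \<in> opoints" "location A = p" "heading A = a" using opoint_exists[OF assms(1)] .
  moreover obtain B where "B \<in> opoints" "location B = q" "heading B = b" using opoint_exists[OF assms(2)] .
  moreover obtain C where "C \<in> opoints" "location C = r" "heading C = c" using opoint_exists[OF assms(3)] .
  ultimately show ?thesis unfolding composable_def using assms(4) by blast
qed

lemma inverse_in_unit_sector_iff:
  assumes "m \<ge> 1"
  shows "inverse z \<in> unit_sector m i \<longleftrightarrow> z \<in> unit_sector m (- i)"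
  using inverse_in_unit_sector[OF assms, of z "- i"] inverse_in_unit_sector[OF assms, of "inverse z" i]
  by auto

lemma turnI:
  assumes "m \<ge> 1" "x \<in> unit_sector m i" "y \<in> unit_sector m j" "z \<in> unit_sector m k" "x * y * z = 1"
  shows "turn m i j k"
  using turn_iff_unit_sector[OF assms(1,2)] assms(3-5) by blast

lemma turnE:
  assumes "turn m i j k" "m \<ge> 1" "x \<in> unit_sector m i"
  obtains y z where "y \<in> unit_sector m j" "z \<in> unit_sector m k" "x * y * z = 1"
  using turn_iff_unit_sector[OF assms(2,3)] assms(1) by blast

lemma opra_Same_Same_Same:
  assumes m: "m \<ge> 1"
  shows "opra m (Same i) (Same k) (Same s) \<longleftrightarrow> composable m (Same i) (Same k) (Same s)"
proof
  assume "opra m (Same i) (Same k) (Same s)"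
  then have turn: "turn m i k (- s)" by simp
  obtain x where x: "x \<in> unit_sector m i" using unit_sector_nonempty[OF m] by blast
  obtain y z where y: "y \<in> unit_sector m k" and z: "z \<in> unit_sector m (- s)" and prod: "x * y * z = 1"
    using turnE[OF turn m x] .
  have "x * y = inverse z" using prod by (metis inverse_unique mult.commute)
  then have "x * y \<in> unit_sector m s" using z inverse_in_unit_sector_iff[OF m] by simp
  then show "composable m (Same i) (Same k) (Same s)"
    \<comment> \<open>All points are at the origin, and the successive quotients of the headings are
      \<open>x\<close> and \<open>y\<close>.\<close>
    by (intro composableI[of 1 x "x * y" 0 0 0])
      (use x y in \<open>auto simp: holds_Same_iff norm_mult norm_unit_sector unit_sector_nonzero\<close>)
next
  assume "composable m (Same i) (Same k) (Same s)"
  then obtain A B C where h: "heading B / heading A \<in> unit_sector m i"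
    "heading C / heading B \<in> unit_sector m k" "heading C / heading A \<in> unit_sector m s"
    unfolding composable_def holds_Same_iff by blast
  have "turn m i k (- s)"
    by (rule turnI[OF m h(1,2) inverse_in_unit_sector[OF m h(3)]]) (simp add: heading_nonzero)
  then show "opra m (Same i) (Same k) (Same s)" by simp
qed

text \<open>Since \<open>A\<close> and \<open>B\<close> share their location, \<open>C\<close> sees
  both in the same direction, whence \<open>l = t\<close>. The turn relates the heading change from
  \<open>A\<close> to \<open>B\<close> to the angles at which the two see \<open>C\<close>.\<close>

lemma opra_Same_Distinct_Distinct:
  assumes m: "m \<ge> 1" and ran: "l \<in> {0..<4 * m}" "t \<in> {0..<4 * m}"
  shows "opra m (Same i) (Distinct k l) (Distinct s t) \<longleftrightarrow>
    composable m (Same i) (Distinct k l) (Distinct s t)"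
proof
  assume "opra m (Same i) (Distinct k l) (Distinct s t)"
  then have lt: "l = t" and turn: "turn m i k (- s)" by simp_all
  obtain x where x: "x \<in> unit_sector m i" using unit_sector_nonempty[OF m] by blast
  obtain y z where y: "y \<in> unit_sector m k" and z: "z \<in> unit_sector m (- s)" and prod: "x * y * z = 1"
    using turnE[OF turn m x] .
  obtain c where c: "c \<in> unit_sector m t" using unit_sector_nonempty[OF m] by blast
  have nz: "x \<noteq> 0" "y \<noteq> 0" "z \<noteq> 0" "c \<noteq> 0" using x y z c unit_sector_nonzero by blast+
  have "inverse y / z = x" "1 / z \<in> unit_sector m s"
    using prod nz z inverse_in_unit_sector_iff[OF m, of z] by (simp_all add: field_simps)
  then show "composable m (Same i) (Distinct k l) (Distinct s t)"
    \<comment> \<open>Both \<open>A\<close> and \<open>B\<close> are at 0 and \<open>C\<close> is at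
      1. The headings are solved from the angles: \<open>A\<close> sees \<open>C\<close> at
      \<open>1 / z\<close>, \<open>B\<close> sees it at \<open>y\<close>, and \<open>C\<close> looks
      back in direction -1 at angle \<open>c\<close>.\<close>
    by (intro composableI[of z "inverse y" "- inverse c" 0 0 1])
      (use x y c in \<open>simp_all add: holds_Same_iff holds_Distinct_iff norm_unit_sector[OF z]
        norm_unit_sector[OF y] norm_unit_sector[OF c] norm_inverse sgn_minus divide_inverse lt\<close>)
next
  assume "composable m (Same i) (Distinct k l) (Distinct s t)"
  then obtain A B C where AB: "location A = location B" "heading B / heading A \<in> unit_sector m i"
    and BC: "location B \<noteq> location C" "sgn (location C - location B) / heading B \<in> unit_sector m k"
      "sgn (location B - location C) / heading C \<in> unit_sector m l"
    and AC: "sgn (location C - location A) / heading A \<in> unit_sector m s"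
      "sgn (location A - location C) / heading C \<in> unit_sector m t"
    unfolding composable_def holds_Same_iff holds_Distinct_iff by blast
  have "l = t" using unit_sector_unique[OF m BC(3) _ ran] AC(2) AB(1) by simp
  moreover have "turn m i k (- s)"
    by (rule turnI[OF m AB(2) BC(2) inverse_in_unit_sector[OF m AC(1)]])
      (use BC(1) in \<open>simp add: AB(1) heading_nonzero sgn_zero_iff\<close>)
  ultimately show "opra m (Same i) (Distinct k l) (Distinct s t)" by simp
qed

lemma opra_Distinct_Same_Distinct:
  assumes m: "m \<ge> 1" and ran: "i \<in> {0..<4 * m}" "s \<in> {0..<4 * m}"
  shows "opra m (Distinct i j) (Same k) (Distinct s t) \<longleftrightarrow>
    composable m (Distinct i j) (Same k) (Distinct s t)"
proof
  assume "opra m (Distinct i j) (Same k) (Distinct s t)"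
  then have i_eq: "i = s" and turn: "turn m t k (- j)" by simp_all
  obtain x where x: "x \<in> unit_sector m t" using unit_sector_nonempty[OF m] by blast
  obtain y z where y: "y \<in> unit_sector m k" and z: "z \<in> unit_sector m (- j)" and prod: "x * y * z = 1"
    using turnE[OF turn m x] .
  obtain a where a: "a \<in> unit_sector m s" using unit_sector_nonempty[OF m] by blast
  have nz: "x \<noteq> 0" "y \<noteq> 0" "z \<noteq> 0" "a \<noteq> 0" using x y z a unit_sector_nonzero by blast+
  have "1 / (y * z) = x" "1 / z \<in> unit_sector m j"
    using prod nz z inverse_in_unit_sector_iff[OF m, of z] by (simp_all add: field_simps)
  then show "composable m (Distinct i j) (Same k) (Distinct s t)"
    \<comment> \<open>Now \<open>A\<close> is at 0 while \<open>B\<close> and \<open>C\<close> are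
      at 1. Looking back in direction -1, \<open>B\<close> sees \<open>A\<close> at
      \<open>1 / z\<close> and \<open>C\<close> sees it at \<open>1 / (y * z) = x\<close>.\<close>
    by (intro composableI[of "inverse a" "- z" "- (y * z)" 0 1 1])
      (use x y a nz in \<open>simp_all add: holds_Same_iff holds_Distinct_iff norm_unit_sector[OF z]
        norm_unit_sector[OF y] norm_unit_sector[OF a] norm_inverse norm_mult
        sgn_minus divide_inverse mult.assoc i_eq\<close>)
next
  assume "composable m (Distinct i j) (Same k) (Distinct s t)"
  then obtain A B C where BC: "location B = location C" "heading C / heading B \<in> unit_sector m k"
    and AB: "location A \<noteq> location B" "sgn (location B - location A) / heading A \<in> unit_sector m i"
      "sgn (location A - location B) / heading B \<in> unit_sector m j"
    and AC: "sgn (location C - location A) / heading A \<in> unit_sector m s"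
      "sgn (location A - location C) / heading C \<in> unit_sector m t"
    unfolding composable_def holds_Same_iff holds_Distinct_iff by blast
  have "i = s" using unit_sector_unique[OF m AB(2) _ ran] AC(1) BC(1) by simp
  moreover have "turn m t k (- j)"
    by (rule turnI[OF m AC(2) BC(2) inverse_in_unit_sector[OF m AB(3)]])
      (use AB(1) in \<open>simp add: BC(1) heading_nonzero sgn_zero_iff\<close>)
  ultimately show "opra m (Distinct i j) (Same k) (Distinct s t)" by simp
qed

lemma opra_Distinct_Distinct_Same:
  assumes m: "m \<ge> 1" and ran: "j \<in> {0..<4 * m}" "k \<in> {0..<4 * m}"
  shows "opra m (Distinct i j) (Distinct k l) (Same s) \<longleftrightarrow>
    composable m (Distinct i j) (Distinct k l) (Same s)"
proof
  assume "opra m (Distinct i j) (Distinct k l) (Same s)"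
  then have jk: "j = k" and turn: "turn m i (- l) (- s)" by simp_all
  obtain x where x: "x \<in> unit_sector m i" using unit_sector_nonempty[OF m] by blast
  obtain y z where y: "y \<in> unit_sector m (- l)" and z: "z \<in> unit_sector m (- s)" and prod: "x * y * z = 1"
    using turnE[OF turn m x] .
  obtain b where b: "b \<in> unit_sector m k" using unit_sector_nonempty[OF m] by blast
  have nz: "x \<noteq> 0" "y \<noteq> 0" "z \<noteq> 0" "b \<noteq> 0" using x y z b unit_sector_nonzero by blast+
  have "y * x = 1 / z" using prod nz by (simp add: field_simps)
  then have "y * x \<in> unit_sector m s" "1 / y \<in> unit_sector m l"
    using y z inverse_in_unit_sector_iff[OF m] by (simp_all flip: inverse_eq_divide)
  then show "composable m (Distinct i j) (Distinct k l) (Same s)"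
    \<comment> \<open>Here \<open>A\<close> and \<open>C\<close> are at 0 and \<open>B\<close> is at
      1; \<open>A\<close> sees \<open>B\<close> at \<open>x\<close> and \<open>C\<close> sees it at
      \<open>1 / y\<close>.\<close>
    by (intro composableI[of "inverse x" "- inverse b" y 0 1 0])
      (use x b in \<open>simp_all add: holds_Same_iff holds_Distinct_iff norm_unit_sector[OF x]
        norm_unit_sector[OF y] norm_unit_sector[OF b] norm_inverse sgn_minus divide_inverse jk\<close>)
next
  assume "composable m (Distinct i j) (Distinct k l) (Same s)"
  then obtain A B C where AC: "location A = location C" "heading C / heading A \<in> unit_sector m s"
    and AB: "location A \<noteq> location B" "sgn (location B - location A) / heading A \<in> unit_sector m i"
      "sgn (location A - location B) / heading B \<in> unit_sector m j"
    and BC: "sgn (location C - location B) / heading B \<in> unit_sector m k"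
      "sgn (location B - location C) / heading C \<in> unit_sector m l"
    unfolding composable_def holds_Same_iff holds_Distinct_iff by blast
  have "j = k" using unit_sector_unique[OF m AB(3) _ ran] BC(1) AC(1) by simp
  moreover have "turn m i (- l) (- s)"
    by (rule turnI[OF m AB(2) inverse_in_unit_sector[OF m BC(2)] inverse_in_unit_sector[OF m AC(2)]])
      (use AB(1) in \<open>simp add: AC(1) heading_nonzero sgn_zero_iff\<close>)
  ultimately show "opra m (Distinct i j) (Distinct k l) (Same s)" by simp
qed

text \<open>The indices \<open>u\<close>, \<open>v\<close>, \<open>w\<close> belong to the angles at
  \<open>A\<close> from \<open>C\<close> to \<open>B\<close>, at \<open>B\<close> from
  \<open>A\<close> to \<open>C\<close>, and at \<open>C\<close> from \<open>B\<close> to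
  \<open>A\<close>. Each heading occurs only in the turn of its own vertex.\<close>

lemma opra_Distinct_Distinct_Distinct:
  assumes m: "m \<ge> 1"
  shows "opra m (Distinct i j) (Distinct k l) (Distinct s t) \<longleftrightarrow>
    composable m (Distinct i j) (Distinct k l) (Distinct s t)"
proof
  assume "opra m (Distinct i j) (Distinct k l) (Distinct s t)"
  then obtain u v w where ran: "u \<in> {0..<4 * m}" "v \<in> {0..<4 * m}" "w \<in> {0..<4 * m}"
    and turn: "turn m u (- i) s" "turn m v (- k) j" "turn m w (- t) l" and tri: "triangle m u v w"
    by auto
  obtain x y z where xyz: "x \<in> unit_sector m u" "y \<in> unit_sector m v" "z \<in> unit_sector m w"
    "triangle_angles x y z"
    using tri triangle_iff_unit_sector[OF m ran] by blast
  obtain p q r where dist: "p \<noteq> q" "q \<noteq> r" "p \<noteq> r" and x: "x = sgn (q - p) / sgn (r - p)"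
    and y: "y = sgn (r - q) / sgn (p - q)" and z: "z = sgn (p - r) / sgn (q - r)"
    using points_of_triangle_angles[OF xyz(4)] xyz(1-3) norm_unit_sector by metis
  \<comment> \<open>With \<open>d / e\<close> prescribed as first factor of the turn,
    \<open>h = d * f\<close> is the heading for which the direction \<open>d\<close> appears at
    \<open>inverse f\<close> and \<open>e\<close> at \<open>g\<close>.\<close>
  have heading: "\<exists>h. norm h = 1 \<and> d / h \<in> unit_sector m i \<and> e / h \<in> unit_sector m s"
    if de: "turn m u (- i) s" "d / e \<in> unit_sector m u" "norm d = 1" "norm e = 1" for u i s d e
  proof -
    obtain f g where f: "f \<in> unit_sector m (- i)" and g: "g \<in> unit_sector m s" and "d / e * f * g = 1"
      using turnE[OF de(1) m de(2)] .
    moreover have "f \<noteq> 0" "g \<noteq> 0" "d \<noteq> 0" "e \<noteq> 0" using f g de unit_sector_nonzero by auto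
    ultimately have "d / (d * f) = inverse f" "e / (d * f) = g" by (simp_all add: field_simps)
    then show ?thesis using f g de(3) norm_unit_sector[OF f] inverse_in_unit_sector_iff[OF m]
      by (intro exI[of _ "d * f"]) (simp add: norm_mult)
  qed
  have unit: "norm (sgn d) = 1" if "d \<noteq> 0" for d :: complex using that by (simp add: norm_sgn)
  obtain a where "norm a = 1" "sgn (q - p) / a \<in> unit_sector m i" "sgn (r - p) / a \<in> unit_sector m s"
    using heading[OF turn(1), of "sgn (q - p)" "sgn (r - p)"] xyz(1) dist unit by (auto simp: x)
  moreover obtain b where "norm b = 1" "sgn (r - q) / b \<in> unit_sector m k" "sgn (p - q) / b \<in> unit_sector m j"
    using heading[OF turn(2), of "sgn (r - q)" "sgn (p - q)"] xyz(2) dist unit by (auto simp: y)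
  moreover obtain c where "norm c = 1" "sgn (p - r) / c \<in> unit_sector m t" "sgn (q - r) / c \<in> unit_sector m l"
    using heading[OF turn(3), of "sgn (p - r)" "sgn (q - r)"] xyz(3) dist unit by (auto simp: z)
  ultimately show "composable m (Distinct i j) (Distinct k l) (Distinct s t)"
    using dist by (intro composableI[of a b c p q r]) (auto simp: holds_Distinct_iff)
next
  assume "composable m (Distinct i j) (Distinct k l) (Distinct s t)"
  then obtain A B C where
    AB: "location A \<noteq> location B" "sgn (location B - location A) / heading A \<in> unit_sector m i"
      "sgn (location A - location B) / heading B \<in> unit_sector m j"
    and BC: "location B \<noteq> location C" "sgn (location C - location B) / heading B \<in> unit_sector m k"
      "sgn (location B - location C) / heading C \<in> unit_sector m l"
    and AC: "location A \<noteq> location C" "sgn (location C - location A) / heading A \<in> unit_sector m s"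
      "sgn (location A - location C) / heading C \<in> unit_sector m t"
    unfolding composable_def holds_Distinct_iff by blast
  \<comment> \<open>The sector containing \<open>d / e\<close> serves as \<open>u\<close>; the
    product behind the turn is \<open>(d / e) * (h / d) * (e / h) = 1\<close>.\<close>
  have turn_ex: "\<exists>u\<in>{0..<4 * m}. d / e \<in> unit_sector m u \<and> turn m u (- i) s"
    if "d / h \<in> unit_sector m i" "e / h \<in> unit_sector m s" for i s d e h
  proof -
    have nz: "d \<noteq> 0" "e \<noteq> 0" "h \<noteq> 0" using that[THEN unit_sector_nonzero] by auto
    have "norm (d / e) = 1"
      using that[THEN norm_unit_sector] nz by (simp add: norm_divide)
    then obtain u where u: "u \<in> {0..<4 * m}" "d / e \<in> unit_sector m u"
      using unit_sectors_cover[OF m] by blast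
    have "turn m u (- i) s"
      by (rule turnI[OF m u(2) inverse_in_unit_sector[OF m that(1)] that(2)]) (simp add: nz)
    then show ?thesis using u by blast
  qed
  obtain u where u: "u \<in> {0..<4 * m}" "turn m u (- i) s"
      "sgn (location B - location A) / sgn (location C - location A) \<in> unit_sector m u"
    using turn_ex[OF AB(2) AC(2)] by blast
  obtain v where v: "v \<in> {0..<4 * m}" "turn m v (- k) j"
      "sgn (location C - location B) / sgn (location A - location B) \<in> unit_sector m v"
    using turn_ex[OF BC(2) AB(3)] by blast
  obtain w where w: "w \<in> {0..<4 * m}" "turn m w (- t) l"
      "sgn (location A - location C) / sgn (location B - location C) \<in> unit_sector m w"
    using turn_ex[OF AC(3) BC(3)] by blast
  have "triangle m u v w"
    using triangle_iff_unit_sector[OF m u(1) v(1) w(1)] u(3) v(3) w(3)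
      triangle_angles_of_points[OF AB(1) BC(1) AC(1)] by blast
  then show "opra m (Distinct i j) (Distinct k l) (Distinct s t)" using u v w unfolding opra.simps by blast
qed

lemma opra_iff_composable:
  assumes m: "m \<ge> 1"
    and "b1 \<in> base_relations m" "b2 \<in> base_relations m" "b3 \<in> base_relations m"
  shows "opra m b1 b2 b3 \<longleftrightarrow> composable m b1 b2 b3"
proof -
  \<comment> \<open>Equality of locations is an equivalence relation, so it cannot fail for exactly
    one of the three pairs.\<close>
  have mismatch: "\<not> composable m (Same i) (Same k) (Distinct s t)"
    "\<not> composable m (Same i) (Distinct k t) (Same s)"
    "\<not> composable m (Distinct i t) (Same k) (Same s)" for i k s t
    unfolding composable_def holds_Same_iff holds_Distinct_iff by auto
  show ?thesis
    using assms(2-4) opra_Same_Same_Same[OF m] opra_Same_Distinct_Distinct[OF m]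
      opra_Distinct_Same_Distinct[OF m] opra_Distinct_Distinct_Same[OF m]
      opra_Distinct_Distinct_Distinct[OF m] mismatch
    by (cases b1; cases b2; cases b3)
      (simp_all only: opra.simps(2-4) base_relations_def Un_iff mem_Collect_eq
        base_relation.simps simp_thms ex_simps, auto)
qed

theorem theorem4:
  fixes m :: int and b1 b2 b3 :: base_relation
  assumes "m \<ge> 1"
    and "b1 \<in> base_relations m" and "b2 \<in> base_relations m" and "b3 \<in> base_relations m"
  shows "(opra m b1 b2 b3 \<longleftrightarrow> b3 \<in> weak_comp m b1 b2) \<and>
         (opra m b1 b2 b3 \<longleftrightarrow>
            (\<exists>A\<in>opoints. \<exists>B\<in>opoints. \<exists>C\<in>opoints.
               holds m b1 A B \<and> holds m b2 B C \<and> holds m b3 A C))"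
proof -
  have "b3 \<in> weak_comp m b1 b2 \<longleftrightarrow> composable m b1 b2 b3"
    using assms(4) by (auto simp: weak_comp_def rel_of_def composable_def)
  then show ?thesis using opra_iff_composable[OF assms] by (simp add: composable_def)
qed

end
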